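(* Let $H\in\mathbb{S}^n$, let $A\in\mathbb{R}^{m\times n}$ have full row rank with $m<n$, and let $Z\in\mathbb{R}^{n\times(n-m)}$ have orthonormal columns spanning $\mathcal{N}(A)$. Then $$\lambda_{\max}(Z^{\mathrm T}HZ)=\inf_{\rho\in\mathbb{R}}\lambda_{\max}\bigl(H-\rho A^{\mathrm T}A\bigr).$$
   Context: $\mathbb{S}^n$ denotes the space of $n\times n$ real symmetric matrices, $\mathcal{N}(A)$ the null space of $A$, and $\lambda_{\max}(M)$ the largest eigenvalue of a symmetric matrix $M$. *)

theory Defs
  imports "HOL-Analysis.Analysis"
begin

definition symmetric_matrix :: "real^'n^'n \<Rightarrow> bool" where
  "symmetric_matrix M \<longleftrightarrow> transpose M = M"

definition null_space :: "real^'n^'m \<Rightarrow> (real^'n) set" where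
  "null_space A = {x. A *v x = 0}"

text \<open>Orthonormality is stated on column indices rather than on the set of columns, so that
  repeated columns are excluded.\<close>

definition orthonormal_columns :: "real^'k^'n \<Rightarrow> bool" where
  "orthonormal_columns Z \<longleftrightarrow>
     (\<forall>i j. column i Z \<bullet> column j Z = (if i = j then 1 else 0))"

definition eigenvalues :: "real^'n^'n \<Rightarrow> real set" where
  "eigenvalues M = {\<mu>. \<exists>v. v \<noteq> 0 \<and> M *v v = \<mu> *\<^sub>R v}"

text \<open>Meaningful for symmetric matrices only: their set of real eigenvalues is finite and
  nonempty.\<close>

definition lambda_max :: "real^'n^'n \<Rightarrow> real" where
  "lambda_max M = Max (eigenvalues M)"

end

theory Submission
  imports Defs
begin

text \<open>By the Rayleigh principle \<open>\<lambda>\<^sub>m\<^sub>a\<^sub>x(M)\<close> is the maximum of \<open>x \<bullet> M x\<close> over unit vectors. On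
  \<open>\<N>(A)\<close> the penalty \<open>\<rho> \<parallel>A x\<parallel>\<^sup>2\<close> vanishes, which gives \<open>\<le>\<close>. Conversely, if
  \<open>\<lambda>\<^sub>m\<^sub>a\<^sub>x(H - \<rho> A\<^sup>T A) \<ge> c\<close> for all \<open>\<rho>\<close>, then the compact sets of unit vectors with
  \<open>x \<bullet> H x - k \<parallel>A x\<parallel>\<^sup>2 \<ge> c\<close> are nonempty and decrease in \<open>k\<close>; a common point lies in \<open>\<N>(A)\<close> and
  satisfies \<open>x \<bullet> H x \<ge> c\<close>.\<close>

lemma inner_vector_matrix_mult:
  fixes A :: "real^'n^'m"
  shows "x \<bullet> (y v* A) = (A *v x) \<bullet> y"
  by (metis dot_lmul_matrix inner_commute)

lemma symmetric_matrix_inner: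
  assumes "symmetric_matrix M"
  shows "x \<bullet> (M *v y) = (M *v x) \<bullet> y"
  using inner_vector_matrix_mult[of x y M] assms
  by (metis symmetric_matrix_def transpose_matrix_vector)

text \<open>First-order optimality without derivatives: at \<open>v + t *\<^sub>R w\<close>, with
  \<open>w\<close> the residual \<open>M *v v - \<mu> *\<^sub>R v\<close>, the slack in
  \<open>bound\<close> equals \<open>t\<^sup>2 * q - 2 * t * (w \<bullet> w)\<close>. If
  \<open>w\<close> were nonzero, this would be negative for small positive \<open>t\<close>.\<close>

lemma rayleigh_maximizer_eigenvector:
  fixes M :: "real^'n^'n"
  assumes sym: "symmetric_matrix M"
    and bound: "\<And>x. x \<bullet> (M *v x) \<le> \<mu> * (x \<bullet> x)"
    and eq: "v \<bullet> (M *v v) = \<mu> * (v \<bullet> v)"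
  shows "M *v v = \<mu> *\<^sub>R v"
proof (rule ccontr)
  assume "M *v v \<noteq> \<mu> *\<^sub>R v"
  define w where "w = M *v v - \<mu> *\<^sub>R v"
  define q where "q = \<mu> * (w \<bullet> w) - w \<bullet> (M *v w)"
  \<comment> \<open>The slack is negative for \<open>0 < t\<close> with
    \<open>t * q < 2 * (w \<bullet> w)\<close>. The \<open>+ 1\<close> keeps the denominator
    positive when \<open>q = 0\<close> and still gives
    \<open>t * q \<le> w \<bullet> w\<close>.\<close>
  define t where "t = (w \<bullet> w) / (q + 1)"
  have "w \<bullet> w > 0"
    using \<open>M *v v \<noteq> \<mu> *\<^sub>R v\<close> by (simp add: w_def)
  have "q \<ge> 0"
    using bound[of w] by (simp add: q_def)
  have "t > 0"
    using \<open>w \<bullet> w > 0\<close> \<open>q \<ge> 0\<close> by (simp add: t_def)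
  have Mv: "M *v v = w + \<mu> *\<^sub>R v"
    by (simp add: w_def)
  have vMw: "v \<bullet> (M *v w) = w \<bullet> w + \<mu> * (v \<bullet> w)"
    by (simp add: symmetric_matrix_inner[OF sym] Mv inner_add_left)
  have "(v + t *\<^sub>R w) \<bullet> (M *v (v + t *\<^sub>R w)) =
      v \<bullet> (M *v v) + t * (v \<bullet> (M *v w)) + t * (w \<bullet> (M *v v)) + t\<^sup>2 * (w \<bullet> (M *v w))"
    by (simp add: matrix_vector_right_distrib matrix_vector_mult_scaleR inner_add_left
        inner_add_right power2_eq_square algebra_simps)
  also have "\<dots> = \<mu> * (v \<bullet> v) + 2 * t * (w \<bullet> w) + 2 * t * \<mu> * (v \<bullet> w) + t\<^sup>2 * (w \<bullet> (M *v w))"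
    unfolding eq vMw by (simp add: Mv inner_add_right inner_commute algebra_simps)
  finally have "2 * t * (w \<bullet> w) \<le> t\<^sup>2 * q"
    using bound[of "v + t *\<^sub>R w"]
    by (simp add: q_def inner_add_left inner_add_right inner_commute power2_eq_square algebra_simps)
  then have "2 * (w \<bullet> w) \<le> t * q"
    using \<open>t > 0\<close> by (simp add: power2_eq_square)
  also have "t * q \<le> t * (q + 1)"
    using \<open>t > 0\<close> by simp
  also have "\<dots> = w \<bullet> w"
    using \<open>q \<ge> 0\<close> by (simp add: t_def)
  finally show False
    using \<open>w \<bullet> w > 0\<close> by simp
qed

text \<open>The quadratic form attains its maximum on the compact unit sphere; homogeneity carries
  the bound to all vectors, and the maximizer is then an eigenvector.\<close>

lemma rayleigh_maximum_eigenvalue: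
  fixes M :: "real^'n^'n"
  assumes sym: "symmetric_matrix M"
  obtains \<mu> where "\<mu> \<in> eigenvalues M" "\<And>x. x \<bullet> (M *v x) \<le> \<mu> * (x \<bullet> x)"
proof -
  have cont: "continuous_on (sphere 0 1) (\<lambda>x. x \<bullet> (M *v x))"
    by (intro continuous_intros)
  have "sphere (0::real^'n) 1 \<noteq> {}"
    by simp
  then obtain v where v: "v \<in> sphere 0 1"
    and max: "\<And>x. x \<in> sphere 0 1 \<Longrightarrow> x \<bullet> (M *v x) \<le> v \<bullet> (M *v v)"
    using continuous_attains_sup[OF compact_sphere _ cont] by blast
  define \<mu> where "\<mu> = v \<bullet> (M *v v)"
  have bound: "x \<bullet> (M *v x) \<le> \<mu> * (x \<bullet> x)" for x
  proof (cases "x = 0")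
    case False
    have "sgn x \<bullet> (M *v sgn x) \<le> \<mu>"
      unfolding \<mu>_def using False by (intro max) (simp add: norm_sgn)
    then show ?thesis
      using False
      by (simp add: sgn_div_norm matrix_vector_mult_scaleR dot_square_norm power2_eq_square field_simps)
  qed simp
  have "M *v v = \<mu> *\<^sub>R v"
    using v by (intro rayleigh_maximizer_eigenvector[OF sym bound]) (simp add: \<mu>_def dot_square_norm)
  moreover have "v \<noteq> 0"
    using v by auto
  ultimately show thesis
    using that[OF _ bound] by (auto simp: eigenvalues_def)
qed

text \<open>Eigenvectors for distinct eigenvalues are orthogonal, hence independent, and an
  independent set in a Euclidean space is finite. This is needed for \<open>Max\<close> in
  \<open>lambda_max\<close> to be a genuine maximum.\<close>

lemma finite_eigenvalues:
  fixes M :: "real^'n^'n"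
  assumes sym: "symmetric_matrix M"
  shows "finite (eigenvalues M)"
proof -
  have "\<forall>\<mu>\<in>eigenvalues M. \<exists>v. v \<noteq> 0 \<and> M *v v = \<mu> *\<^sub>R v"
    by (simp add: eigenvalues_def)
  then obtain f where f: "\<And>\<mu>. \<mu> \<in> eigenvalues M \<Longrightarrow> f \<mu> \<noteq> 0 \<and> M *v f \<mu> = \<mu> *\<^sub>R f \<mu>"
    by metis
  have orth: "f \<mu> \<bullet> f \<nu> = 0" if "\<mu> \<in> eigenvalues M" "\<nu> \<in> eigenvalues M" "\<mu> \<noteq> \<nu>" for \<mu> \<nu>
    using symmetric_matrix_inner[OF sym, of "f \<mu>" "f \<nu>"] that by (simp add: f)
  \<comment> \<open>A vector chosen for two distinct eigenvalues would be orthogonal to itself,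
    hence zero.\<close>
  have inj: "inj_on f (eigenvalues M)"
    using orth f by (intro inj_onI) (metis inner_eq_zero_iff)
  have "pairwise orthogonal (f ` eigenvalues M)"
    using orth by (auto simp: pairwise_def orthogonal_def)
  then have "independent (f ` eigenvalues M)"
    using f by (intro pairwise_orthogonal_independent) auto
  then show ?thesis
    using inj finite_imageD independent_imp_finite by blast
qed

lemma lambda_max_eigenvalue:
  assumes "symmetric_matrix M"
  shows "lambda_max M \<in> eigenvalues M"
  unfolding lambda_max_def
  by (metis Max_in assms empty_iff finite_eigenvalues rayleigh_maximum_eigenvalue)

lemma rayleigh_le_lambda_max:
  assumes sym: "symmetric_matrix M"
  shows "x \<bullet> (M *v x) \<le> lambda_max M * (x \<bullet> x)"
proof -
  obtain \<mu> where \<mu>: "\<mu> \<in> eigenvalues M" "\<And>x. x \<bullet> (M *v x) \<le> \<mu> * (x \<bullet> x)"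
    using rayleigh_maximum_eigenvalue[OF sym] by blast
  have "\<mu> \<le> lambda_max M"
    unfolding lambda_max_def using \<mu>(1) finite_eigenvalues[OF sym] by simp
  then show ?thesis
    using \<mu>(2)[of x] mult_right_mono[of \<mu> "lambda_max M" "x \<bullet> x"] by simp
qed

lemma lambda_max_attained:
  assumes "symmetric_matrix M"
  obtains v where "v \<bullet> v = 1" "v \<bullet> (M *v v) = lambda_max M"
proof -
  obtain v where "v \<noteq> 0" "M *v v = lambda_max M *\<^sub>R v"
    using lambda_max_eigenvalue[OF assms] by (auto simp: eigenvalues_def)
  then show thesis
    using that[of "sgn v"]
    by (simp add: sgn_div_norm matrix_vector_mult_scaleR dot_square_norm power2_eq_square
        field_simps)
qed

lemma quadratic_form_penalty:
  fixes H :: "real^'n^'n" and A :: "real^'n^'m"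
  shows "x \<bullet> ((H - \<rho> *\<^sub>R (transpose A ** A)) *v x) = x \<bullet> (H *v x) - \<rho> * ((A *v x) \<bullet> (A *v x))"
proof -
  have "(transpose A ** A) *v x = (A *v x) v* A"
    by (simp flip: matrix_vector_mul_assoc)
  then show ?thesis
    by (simp add: matrix_vector_mult_diff_rdistrib inner_diff_right
        inner_vector_matrix_mult flip: scaleR_matrix_vector_assoc)
qed

lemma quadratic_form_congruence:
  fixes H :: "real^'n^'n" and Z :: "real^'k^'n"
  shows "y \<bullet> ((transpose Z ** H ** Z) *v y) = (Z *v y) \<bullet> (H *v (Z *v y))"
  by (simp add: inner_vector_matrix_mult flip: matrix_vector_mul_assoc)

lemma symmetric_matrix_penalty:
  assumes "symmetric_matrix H"
  shows "symmetric_matrix (H - \<rho> *\<^sub>R (transpose A ** A))"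
proof -
  have "transpose (transpose A ** A) = transpose A ** A"
    by (simp add: matrix_transpose_mul)
  then show ?thesis
    using assms by (simp add: symmetric_matrix_def transpose_def vec_eq_iff)
qed

lemma symmetric_matrix_congruence:
  assumes "symmetric_matrix H"
  shows "symmetric_matrix (transpose Z ** H ** Z)"
  using assms by (simp add: symmetric_matrix_def matrix_transpose_mul matrix_mul_assoc)

text \<open>Orthonormality says that \<open>transpose Z ** Z\<close> is the identity, so
  \<open>Z\<close> is an isometry and transfers unit vectors in both directions between its domain
  and its range.\<close>

lemma orthonormal_columns_inner:
  fixes Z :: "real^'k^'n"
  assumes "orthonormal_columns Z"
  shows "(Z *v y) \<bullet> (Z *v y) = y \<bullet> y"
proof -
  have "transpose Z ** Z = mat 1"
    using assms
    by (simp add: matrix_mult_transpose_dot_column orthonormal_columns_def mat_def vec_eq_iff)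
  then show ?thesis
    by (metis inner_vector_matrix_mult matrix_vector_mul_assoc matrix_vector_mul_lid
        transpose_matrix_vector)
qed

lemma range_matrix_vector_mult:
  fixes Z :: "real^'k^'n"
  shows "range ((*v) Z) = span (columns Z)"
proof
  show "range ((*v) Z) \<subseteq> span (columns Z)"
    by (auto intro: matrix_vector_mult_in_columnspace)
  show "span (columns Z) \<subseteq> range ((*v) Z)"
  proof (rule span_minimal)
    show "columns Z \<subseteq> range ((*v) Z)"
      by (auto simp: columns_def simp flip: matrix_vector_mult_basis)
  qed (simp add: linear_subspace_image)
qed

text \<open>Cantor's intersection theorem replaces the choice of a convergent subsequence of
  near-maximizers; integer penalties suffice for this.\<close>

lemma penalty_limit:
  fixes H :: "real^'n^'n" and A :: "real^'n^'m"
  assumes "\<And>k::nat. \<exists>x. x \<bullet> x = 1 \<and> x \<bullet> (H *v x) - real k * ((A *v x) \<bullet> (A *v x)) \<ge> c"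
  obtains x where "x \<bullet> x = 1" "A *v x = 0" "x \<bullet> (H *v x) \<ge> c"
proof -
  define F where
    "F k = sphere 0 1 \<inter> {x. c \<le> x \<bullet> (H *v x) - real k * ((A *v x) \<bullet> (A *v x))}" for k
  have "compact (F k)" for k
    unfolding F_def
    by (intro compact_Int_closed compact_sphere closed_Collect_le continuous_intros)
  moreover have "F k \<noteq> {}" for k
    using assms[of k] by (auto simp: F_def norm_eq_1)
  moreover have "F k \<subseteq> F j" if "j \<le> k" for j k
  proof -
    have "real j * ((A *v x) \<bullet> (A *v x)) \<le> real k * ((A *v x) \<bullet> (A *v x))" for x
      using that by (intro mult_right_mono) auto
    then show ?thesis
      unfolding F_def by (force intro: order_trans)
  qed
  ultimately have "\<Inter> (range F) \<noteq> {}"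
    by (intro compact_nest) auto
  then obtain x where x: "\<And>k. x \<in> F k"
    by blast
  \<comment> \<open>Lying in every \<open>F k\<close> bounds all multiples of
    \<open>(A *v x) \<bullet> (A *v x)\<close> by the fixed number
    \<open>x \<bullet> (H *v x) - c\<close>, which the Archimedean property rules out for a positive
    square.\<close>
  have "A *v x = 0"
  proof (rule ccontr)
    assume "A *v x \<noteq> 0"
    then obtain k :: nat where "x \<bullet> (H *v x) - c < real k * ((A *v x) \<bullet> (A *v x))"
      using ex_less_of_nat_mult by (metis inner_gt_zero_iff)
    then show False
      using x[of k] by (simp add: F_def)
  qed
  then show thesis
    using that[of x] x[of 0] by (simp add: F_def norm_eq_1)
qed

text \<open>The infimum is taken in \<open>ereal\<close>, where it always exists; as the left side
  is finite, the equality also says that the family is bounded below.\<close>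

theorem corollary2p8:
  fixes H :: "real^'n^'n" and A :: "real^'n^'m" and Z :: "real^'k^'n"
  assumes "symmetric_matrix H"
    and "CARD('m) < CARD('n)"
    and "rank A = CARD('m)"
    and "CARD('k) = CARD('n) - CARD('m)"
    and "orthonormal_columns Z"
    and "span (columns Z) = null_space A"
  shows "ereal (lambda_max (transpose Z ** H ** Z)) =
    (INF \<rho>::real. ereal (lambda_max (H - \<rho> *\<^sub>R (transpose A ** A))))"
proof (rule antisym)
  let ?P = "\<lambda>\<rho>. H - \<rho> *\<^sub>R (transpose A ** A)" and ?R = "transpose Z ** H ** Z"
  have null: "range ((*v) Z) = {x. A *v x = 0}"
    using assms(6) by (simp add: range_matrix_vector_mult null_space_def)
  note iso = orthonormal_columns_inner[OF assms(5)]
  note symP = symmetric_matrix_penalty[OF assms(1)]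
  note symR = symmetric_matrix_congruence[OF assms(1)]
  show "ereal (lambda_max ?R) \<le> (INF \<rho>. ereal (lambda_max (?P \<rho>)))"
  proof (intro INF_greatest)
    fix \<rho> :: real
    obtain v where v: "v \<bullet> v = 1" "v \<bullet> (?R *v v) = lambda_max ?R"
      using lambda_max_attained[OF symR] .
    have "A *v (Z *v v) = 0"
      using null by blast
    \<comment> \<open>On the null space the form of \<open>?P \<rho>\<close> agrees with that of
      \<open>H\<close> for every \<open>\<rho>\<close>, so one unit vector \<open>Z *v v\<close>
      serves all of them.\<close>
    then have "lambda_max ?R = (Z *v v) \<bullet> (?P \<rho> *v (Z *v v))"
      by (simp add: quadratic_form_penalty flip: v(2) quadratic_form_congruence)
    also have "\<dots> \<le> lambda_max (?P \<rho>)"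
      using rayleigh_le_lambda_max[OF symP, of "Z *v v"] by (simp add: iso v(1))
    finally show "ereal (lambda_max ?R) \<le> ereal (lambda_max (?P \<rho>))"
      by simp
  qed
  show "(INF \<rho>. ereal (lambda_max (?P \<rho>))) \<le> ereal (lambda_max ?R)"
  proof (rule ccontr)
    assume "\<not> ?thesis"
    \<comment> \<open>A real number strictly inside the gap: the limit argument only yields
      \<open>x \<bullet> (H *v x) \<ge> c\<close>, so strictness must come from
      \<open>lambda_max ?R < c\<close>.\<close>
    then obtain c where c: "lambda_max ?R < c" "ereal c < (INF \<rho>. ereal (lambda_max (?P \<rho>)))"
      using ereal_dense2[of "ereal (lambda_max ?R)"] by (auto simp: not_le)
    have c_less: "c < lambda_max (?P \<rho>)" for \<rho>
      using less_INF_D[OF c(2), of \<rho>] by simp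
    have "\<exists>x. x \<bullet> x = 1 \<and> x \<bullet> (H *v x) - real k * ((A *v x) \<bullet> (A *v x)) \<ge> c" for k :: nat
    proof -
      obtain x where "x \<bullet> x = 1" "x \<bullet> (?P (real k) *v x) = lambda_max (?P (real k))"
        using lambda_max_attained[OF symP] .
      then show ?thesis
        using c_less[of "real k"] unfolding quadratic_form_penalty by (intro exI[of _ x]) simp
    qed
    then obtain x where x: "x \<bullet> x = 1" "A *v x = 0" "x \<bullet> (H *v x) \<ge> c"
      by (rule penalty_limit)
    \<comment> \<open>Here the columns of \<open>Z\<close> must span the whole null space: the limit
      vector becomes a competitor \<open>y\<close> for \<open>?R\<close>, of unit length by
      \<open>iso\<close>.\<close>
    then obtain y where "x = Z *v y"
      using null by blast
    then have "x \<bullet> (H *v x) \<le> lambda_max ?R"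
      using rayleigh_le_lambda_max[OF symR, of y] x(1) by (simp add: quadratic_form_congruence iso)
    then show False
      using x(3) c(1) by simp
  qed
qed

end
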